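(* Let $l,m,n$ be positive integers, let $f_{11}(x),\dots,f_{1l}(x),f_{21}(x),\dots,f_{2m}(x),g_1(x),\dots,g_n(x)\in\mathbb{Z}[x]$, and let $\alpha_1,\dots,\alpha_l,\beta_1,\dots,\beta_m,\gamma_1,\dots,\gamma_n$ be positive integers. Let $$f(x)=f_{11}(x)^{\alpha_1}f_{12}(x)^{\alpha_2}\cdots f_{1l}(x)^{\alpha_l}\pm f_{21}(x)^{\beta_1}f_{22}(x)^{\beta_2}\cdots f_{2m}(x)^{\beta_m}$$ (with either choice of sign) and $$g(y)=g_1(y)^{\gamma_1}g_2(y)^{\gamma_2}\cdots g_n(y)^{\gamma_n}.$$ Suppose that: (1) $\deg g(y)<\deg f(x)$; (2) $\deg g(y)>1+\deg\bigl(f_{11}(x)f_{12}(x)\cdots f_{1l}(x)\,f_{21}(x)\cdots f_{2m}(x)\,g_1(x)\cdots g_n(x)\bigr)$; (3) $f_{11}(x)f_{12}(x)\cdots f_{1l}(x)$ and $f_{21}(x)\cdots f_{2m}(x)$ have no common factor in $\mathbb{Z}[x]$ (other than the units $\pm1$); (4) the leading coefficient of each of the products $f_{11}(x)\cdots f_{1l}(x)$, $f_{21}(x)\cdots f_{2m}(x)$, $g_1(x)\cdots g_n(x)$ is positive. If the $ABC$-Conjecture is assumed, then the equation $f(x)=g(y)$ has finitely many solutions $(x,y)$ in integers.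
   Context: The $ABC$-Conjecture is the following assertion: for every fixed $\epsilon>0$ there is a constant $C_\epsilon$ such that, whenever $a,b,c$ are coprime positive integers with $a+b=c$, one has $c\le C_\epsilon\,N(a,b,c)^{1+\epsilon}$, where $N(a,b,c)$ is the product of the distinct prime divisors of $abc$. *)

theory Defs
  imports Complex_Main "HOL-Computational_Algebra.Computational_Algebra"
begin

definition abc_radical :: "nat \<Rightarrow> nat \<Rightarrow> nat \<Rightarrow> nat" where
  "abc_radical a b c = \<Prod>(prime_factors (a * b * c))"

(* "Coprime" for the triple is read as having no common divisor other than 1;
   since a + b = c this is the same as being pairwise coprime. *)
definition ABC_conjecture :: bool where
  "ABC_conjecture \<longleftrightarrow>
    (\<forall>\<epsilon>::real. \<epsilon> > 0 \<longrightarrow>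
      (\<exists>C::real. \<forall>a b c :: nat.
        a > 0 \<and> b > 0 \<and> c > 0 \<and> gcd a (gcd b c) = 1 \<and> a + b = c \<longrightarrow>
        real c \<le> C * real (abc_radical a b c) powr (1 + \<epsilon>)))"

end

(* After division by gcd (A(x), B(x)), which a Bezout identity u A + v B = r in Z[x] bounds
   independently of x, the identity A(x) + B(x) = g(y) is an ABC triple.  Its radical divides
   F1(x) F2(x) G(y), and |x| = O(|y|) because deg g <= deg f.  With D = deg (F1 F2 G), this gives
   |y|^(D+2) = O(|y|^(D (1 + epsilon))), and epsilon = 1/(D+1) bounds |y|. *)
theory Submission
  imports Defs
begin

section \<open>Bezout identities for integer polynomials\<close>

text \<open>Take a nonzero \<open>h\<close> of least degree in the ideal generated by
  \<open>p\<close> and \<open>q\<close>. Up to a constant factor \<open>h\<close> divides every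
  element of the ideal, so by Gauss's lemma its primitive part divides both \<open>p\<close> and
  \<open>q\<close>. Coprimality makes that part a unit, which leaves \<open>h\<close>
  constant.\<close>

lemma coprime_int_poly_bezout:
  fixes p q :: "int poly"
  assumes "coprime p q"
  obtains u v r where "r \<noteq> 0" "u * p + v * q = [:r:]"
proof -
  define I where "I = {h. h \<noteq> 0 \<and> (\<exists>u v. h = u * p + v * q)}"
  have "p \<noteq> 0 \<or> q \<noteq> 0" using assms by auto
  moreover have "p = 1 * p + 0 * q" "q = 0 * p + 1 * q" by auto
  ultimately have "\<exists>h. h \<in> I" unfolding I_def by blast
  then obtain h where h: "h \<in> I" and hmin: "\<And>k. k \<in> I \<Longrightarrow> degree h \<le> degree k"
    using ex_has_least_nat[of "\<lambda>h. h \<in> I" _ degree] by metis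
  from h obtain u v where uv: "h = u * p + v * q" and h0: "h \<noteq> 0" by (auto simp: I_def)
  have div: "primitive_part h dvd s" if s: "s = a * p + b * q" for s a b
  proof -
    obtain c d where cd: "pseudo_divmod s h = (c, d)" by force
    \<comment> \<open>The factor by which pseudo-division scales \<open>s\<close> so that the
      quotient stays in Z[x].\<close>
    define e where "e = lead_coeff h ^ (Suc (degree s) - degree h)"
    have e0: "e \<noteq> 0" using h0 by (simp add: e_def)
    from pseudo_divmod[OF h0 cd] have eq: "smult e s = h * c + d"
      and deg: "d = 0 \<or> degree d < degree h" by (auto simp: e_def)
    have "d = smult e s - h * c" using eq by simp
    also have "\<dots> = (smult e a - u * c) * p + (smult e b - v * c) * q"
      by (simp add: s uv algebra_simps smult_add_right)
    \<comment> \<open>A nonzero remainder would lie in \<open>I\<close> with degree below that of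
      \<open>h\<close>, against minimality.\<close>
    finally have "d = 0" using deg hmin[of d] unfolding I_def by fastforce
    hence "h dvd smult e s" using eq by simp
    \<comment> \<open>Primitive parts are multiplicative, and passing to them reduces the constant
      \<open>e\<close> to a sign.\<close>
    hence "primitive_part h dvd primitive_part (smult e s)"
      by (metis dvdE dvdI primitive_part_mult)
    also have "primitive_part (smult e s) dvd primitive_part s"
      using e0 by (simp add: primitive_part_smult unit_factor_int_def sgn_if)
    also have "primitive_part s dvd s"
      by (metis content_times_primitive_part dvd_smult dvd_refl)
    finally show ?thesis .
  qed
  have "is_unit (primitive_part h)"
    using assms div[of p 1 0] div[of q 0 1] by (simp add: coprime_def)
  hence "degree h = 0" by (metis degree_primitive_part is_unit_polyE degree_pCons_0)
  then obtain r where "h = [:r:]" by (metis degree_eq_zeroE)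
  thus ?thesis using that[of r u v] uv h0 by auto
qed

section \<open>Growth and fibres of integer polynomials\<close>

text \<open>The free majorant \<open>t\<close> lets a value at \<open>x\<close> be bounded by powers
  of a multiple of another variable, as is needed once |x| is compared with |y|.\<close>

lemma abs_poly_int_upper_bound:
  fixes p :: "int poly"
  obtains C :: real where "C > 0"
    "\<And>x t. \<lbrakk>1 \<le> t; \<bar>real_of_int x\<bar> \<le> t\<rbrakk> \<Longrightarrow> \<bar>real_of_int (poly p x)\<bar> \<le> C * t ^ degree p"
proof -
  have "\<exists>C>0. \<forall>x t. 1 \<le> t \<longrightarrow> \<bar>real_of_int x\<bar> \<le> t \<longrightarrow> \<bar>real_of_int (poly p x)\<bar> \<le> C * t ^ degree p"
  proof (induction p)
    case 0
    show ?case by (intro exI[of _ 1]) auto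
  next
    case (pCons a q)
    then obtain C where C: "C > 0" and
      le: "\<And>x t. 1 \<le> t \<Longrightarrow> \<bar>real_of_int x\<bar> \<le> t \<Longrightarrow> \<bar>real_of_int (poly q x)\<bar> \<le> C * t ^ degree q"
      by blast
    show ?case
    proof (cases "q = 0")
      case True
      thus ?thesis by (intro exI[of _ "\<bar>real_of_int a\<bar> + 1"]) auto
    next
      case False
      have "\<bar>real_of_int (poly (pCons a q) x)\<bar> \<le> (\<bar>real_of_int a\<bar> + C) * t ^ degree (pCons a q)"
        if t: "1 \<le> t" "\<bar>real_of_int x\<bar> \<le> t" for x and t :: real
      proof -
        have "\<bar>real_of_int (poly (pCons a q) x)\<bar>
            \<le> \<bar>real_of_int a\<bar> + \<bar>real_of_int x\<bar> * \<bar>real_of_int (poly q x)\<bar>"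
          by (simp flip: abs_mult)
        also have "\<dots> \<le> \<bar>real_of_int a\<bar> * t ^ Suc (degree q) + t * (C * t ^ degree q)"
          using t C le[OF t] one_le_power[OF t(1), of "Suc (degree q)"]
          by (intro add_mono mult_mono mult_right_mono) (auto simp: mult_le_cancel_left1 simp del: power_Suc)
        finally show ?thesis using False by (simp add: algebra_simps)
      qed
      thus ?thesis using C by (intro exI[of _ "\<bar>real_of_int a\<bar> + C"]) auto
    qed
  qed
  thus ?thesis using that by blast
qed

text \<open>Induction along Horner's scheme: for large |x| the term \<open>x * poly q x\<close>
  outweighs the constant coefficient, at the cost of half of the constant \<open>c\<close>.\<close>

lemma abs_poly_int_lower_bound:
  fixes p :: "int poly"
  assumes "p \<noteq> 0"
  obtains c M :: real where "c > 0" "M \<ge> 1"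
    "\<And>x. M \<le> \<bar>real_of_int x\<bar> \<Longrightarrow> c * \<bar>real_of_int x\<bar> ^ degree p \<le> \<bar>real_of_int (poly p x)\<bar>"
proof -
  have "\<exists>c>0. \<exists>M\<ge>1. \<forall>x. M \<le> \<bar>real_of_int x\<bar> \<longrightarrow>
      c * \<bar>real_of_int x\<bar> ^ degree p \<le> \<bar>real_of_int (poly p x)\<bar>"
    using assms
  proof (induction p)
    case 0
    thus ?case by simp
  next
    case (pCons a q)
    show ?case
    proof (cases "q = 0")
      case True
      thus ?thesis using pCons
        by (intro exI[of _ "\<bar>real_of_int a\<bar>"] conjI exI[of _ 1]) auto
    next
      case False
      then obtain c M where c: "c > 0" "M \<ge> 1" and
        le: "\<And>x. M \<le> \<bar>real_of_int x\<bar> \<Longrightarrow> c * \<bar>real_of_int x\<bar> ^ degree q \<le> \<bar>real_of_int (poly q x)\<bar>"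
        using pCons by blast
      \<comment> \<open>Beyond \<open>M'\<close> the bound for \<open>q\<close> applies and |a| is
        at most half of c |x|.\<close>
      define M' where "M' = M + 2 * \<bar>real_of_int a\<bar> / c"
      have "c / 2 * \<bar>real_of_int x\<bar> ^ degree (pCons a q) \<le> \<bar>real_of_int (poly (pCons a q) x)\<bar>"
        if x: "M' \<le> \<bar>real_of_int x\<bar>" for x
      proof -
        define t where "t = \<bar>real_of_int x\<bar>"
        have a0: "2 * \<bar>real_of_int a\<bar> / c \<ge> 0" using c by simp
        have t: "M \<le> t" "2 * \<bar>real_of_int a\<bar> / c \<le> t" "1 \<le> t"
          using x c a0 unfolding t_def M'_def by linarith+
        have "2 * \<bar>real_of_int a\<bar> \<le> c * t" using t(2) c by (simp add: field_simps)
        also have "\<dots> \<le> c * (t * t ^ degree q)"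
          using c t one_le_power[OF t(3), of "degree q"] by (intro mult_left_mono) auto
        finally have 1: "2 * \<bar>real_of_int a\<bar> \<le> c * (t * t ^ degree q)" .
        have "t * (c * t ^ degree q) \<le> t * \<bar>real_of_int (poly q x)\<bar>"
          using le[of x] t by (intro mult_left_mono) (auto simp: t_def)
        also have "\<dots> = \<bar>real_of_int (x * poly q x)\<bar>" by (simp add: t_def abs_mult)
        finally have 2: "c * (t * t ^ degree q) \<le> \<bar>real_of_int (x * poly q x)\<bar>"
          by (simp add: mult_ac)
        have "\<bar>real_of_int (x * poly q x)\<bar>
            \<le> \<bar>real_of_int a\<bar> + \<bar>real_of_int (poly (pCons a q) x)\<bar>"
          by simp
        with 1 2 show ?thesis using False by (simp flip: t_def)
      qed
      moreover have "M' \<ge> 1" using c unfolding M'_def by (simp add: add_increasing2)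
      ultimately show ?thesis using c by (intro exI[of _ "c/2"] conjI exI[of _ M']) auto
    qed
  qed
  thus ?thesis using that by blast
qed

lemma finite_poly_fibre:
  fixes p :: "int poly"
  assumes "degree p > 0"
  shows "finite {x. poly p x = c}"
proof -
  have "p - [:c:] \<noteq> 0" using assms by auto
  from poly_roots_finite[OF this] show ?thesis by simp
qed

section \<open>Radicals and the ABC conjecture for signed integers\<close>

lemma prod_prime_factors_le:
  fixes N :: nat
  assumes "N > 0"
  shows "\<Prod>(prime_factors N) \<le> N"
proof -
  have "\<Prod>(prime_factors N) \<le> (\<Prod>p\<in>prime_factors N. p ^ multiplicity p N)"
    by (intro prod_mono)
       (auto simp: in_prime_factors_iff prime_factors_multiplicity intro!: self_le_power Suc_leI prime_ge_1_nat)
  also have "\<dots> = N" using assms by (simp add: prod_prime_factors)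
  finally show ?thesis .
qed

text \<open>Moving terms across the equation turns a signed triple into a positive one whose sum is
  the largest absolute value. The radical is symmetric in the three entries, so the bound on the
  largest also bounds |c|.\<close>

lemma ABC_conjecture_int:
  assumes ABC_conjecture and "\<epsilon> > 0"
  obtains C :: real where "C > 0"
    "\<And>a b c :: int. \<lbrakk>a \<noteq> 0; b \<noteq> 0; c \<noteq> 0; coprime a b; a + b = c\<rbrakk> \<Longrightarrow>
       \<bar>real_of_int c\<bar> \<le> C * real (\<Prod>(prime_factors (nat \<bar>a * b * c\<bar>))) powr (1 + \<epsilon>)"
proof -
  obtain C0 where C0: "\<forall>a b c. a > 0 \<and> b > 0 \<and> c > 0 \<and> gcd a (gcd b c) = 1 \<and> a + b = c \<longrightarrow>
      real c \<le> C0 * real (abc_radical a b c) powr (1 + \<epsilon>)"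
    using assms(1)[unfolded ABC_conjecture_def, rule_format, OF assms(2)] ..
  \<comment> \<open>The conjecture does not state the sign of its constant; later estimates use a
    positive one.\<close>
  define C where "C = \<bar>C0\<bar> + 1"
  have C: "real c \<le> C * real (\<Prod>(prime_factors (a * b * c))) powr (1 + \<epsilon>)"
    if "a > 0" "b > 0" "coprime a b" "a + b = c" for a b c
  proof -
    have "gcd a (gcd b c) = 1"
      using that(3) by (simp add: coprime_iff_gcd_eq_1 flip: gcd.assoc)
    hence "real c \<le> C0 * real (abc_radical a b c) powr (1 + \<epsilon>)" using that by (intro C0[rule_format]) auto
    also have "\<dots> \<le> C * real (abc_radical a b c) powr (1 + \<epsilon>)"
      by (intro mult_right_mono) (auto simp: C_def)
    finally show ?thesis by (simp add: abc_radical_def)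
  qed
  have "\<bar>real_of_int c\<bar> \<le> C * real (\<Prod>(prime_factors (nat \<bar>a * b * c\<bar>))) powr (1 + \<epsilon>)"
    if 1: "a \<noteq> 0" "b \<noteq> 0" "c \<noteq> 0" "coprime a b" "a + b = c" for a b c :: int
  proof -
    define a' b' c' where "a' = nat \<bar>a\<bar>" and "b' = nat \<bar>b\<bar>" and "c' = nat \<bar>c\<bar>"
    have pos: "a' > 0" "b' > 0" "c' > 0" using 1 by (auto simp: a'_def b'_def c'_def)
    have cop: "coprime a' b'" using 1 by (simp add: a'_def b'_def flip: coprime_int_iff)
    have N: "nat \<bar>a * b * c\<bar> = a' * b' * c'"
      by (simp add: a'_def b'_def c'_def abs_mult nat_mult_distrib)
    have cc: "\<bar>real_of_int c\<bar> = real c'" by (simp add: c'_def)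
    consider "a' + b' = c'" | "c' + b' = a'" | "c' + a' = b'"
      using 1 unfolding a'_def b'_def c'_def by linarith
    thus ?thesis
    proof cases
      case 1
      thus ?thesis using C[of a' b' c'] pos cop unfolding N cc by simp
    next
      case 2
      have "coprime c' b'" using cop unfolding 2[symmetric] by (simp add: coprime_iff_gcd_eq_1)
      hence "real a' \<le> C * real (\<Prod>(prime_factors (c' * b' * a'))) powr (1 + \<epsilon>)"
        using pos 2 by (intro C) auto
      moreover have "real c' \<le> real a'" using 2 by simp
      moreover have "c' * b' * a' = a' * b' * c'" by simp
      ultimately show ?thesis unfolding N cc by (metis order_trans)
    next
      case 3
      have "coprime c' a'" using cop unfolding 3[symmetric] by (simp add: coprime_iff_gcd_eq_1 gcd.commute[of a'])
      hence "real b' \<le> C * real (\<Prod>(prime_factors (c' * a' * b'))) powr (1 + \<epsilon>)"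
        using pos 3 by (intro C) auto
      moreover have "real c' \<le> real b'" using 3 by simp
      moreover have "c' * a' * b' = a' * b' * c'" by simp
      ultimately show ?thesis unfolding N cc by (metis order_trans)
    qed
  qed
  moreover have "C > 0" by (simp add: C_def)
  ultimately show ?thesis using that by blast
qed

section \<open>Finiteness from the ABC bound\<close>

text \<open>Every single exponent is at most the sum of all. This divisibility is the only trace of
  the exponents that the main argument keeps.\<close>

lemma prod_power_dvd_power_prod:
  fixes h :: "'a \<Rightarrow> 'b :: comm_semiring_1"
  assumes "finite I"
  shows "(\<Prod>i\<in>I. h i ^ e i) dvd (\<Prod>i\<in>I. h i) ^ (\<Sum>i\<in>I. e i)"
  unfolding prod_power_distrib
  by (intro prod_dvd_prod le_imp_power_dvd member_le_sum) (auto simp: assms)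

text \<open>The divisibilities say that the primes of A(x), B(x) and g(y) already divide F1(x),
  F2(x) and G(y). Individual factors, their exponents and the sign in front of the second product
  are thereby hidden.\<close>

lemma finite_solutions_of_ABC:
  fixes A B F1 F2 G g :: "int poly"
  assumes ABC_conjecture
    and cop: "coprime A B"
    and dvd: "A dvd F1 ^ N1" "B dvd F2 ^ N2" "g dvd G ^ N3"
    and nz: "F1 \<noteq> 0" "F2 \<noteq> 0" "G \<noteq> 0"
    and deg1: "degree g \<le> degree (A + B)"
    and deg2: "degree g > 1 + degree (F1 * F2 * G)"
  shows "finite {(x, y). poly (A + B) x = poly g y}"
proof -
  define f where "f = A + B"
  define D where "D = degree F1 + degree F2 + degree G"
  have D: "degree g \<ge> D + 2" using deg2 nz by (simp add: degree_mult_eq D_def)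
  have fin_f: "finite {x. poly f x = c}" and fin_g: "finite {y. poly g y = c}" for c
    using finite_poly_fibre[of f c] finite_poly_fibre[of g c] D deg1 by (auto simp: f_def simp del: poly_add)
  have g0: "g \<noteq> 0" and f0: "f \<noteq> 0" using D deg1 by (auto simp: f_def)
  have root: "poly F t \<noteq> 0 \<Longrightarrow> P dvd F ^ N \<Longrightarrow> poly P t \<noteq> 0" for F P :: "int poly" and N t
    by (metis dvdE mult_zero_left poly_mult poly_power power_not_zero)
  obtain u v r where r: "r \<noteq> 0" "u * A + v * B = [:r:]"
    using coprime_int_poly_bezout[OF cop] .
  obtain c M where c: "c > 0" "M \<ge> 1" and low_g:
    "\<And>y. M \<le> \<bar>real_of_int y\<bar> \<Longrightarrow> c * \<bar>real_of_int y\<bar> ^ degree g \<le> \<bar>real_of_int (poly g y)\<bar>"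
    by (rule abs_poly_int_lower_bound[OF g0]) blast
  obtain c' M' where c': "c' > 0" "M' \<ge> 1" and low_f:
    "\<And>x. M' \<le> \<bar>real_of_int x\<bar> \<Longrightarrow> c' * \<bar>real_of_int x\<bar> ^ degree f \<le> \<bar>real_of_int (poly f x)\<bar>"
    by (rule abs_poly_int_lower_bound[OF f0]) blast
  obtain Cg where Cg: "Cg > 0" "\<And>x t. \<lbrakk>1 \<le> t; \<bar>real_of_int x\<bar> \<le> t\<rbrakk> \<Longrightarrow>
      \<bar>real_of_int (poly g x)\<bar> \<le> Cg * t ^ degree g"
    by (rule abs_poly_int_upper_bound) blast
  obtain C1 where C1: "C1 > 0" "\<And>x t. \<lbrakk>1 \<le> t; \<bar>real_of_int x\<bar> \<le> t\<rbrakk> \<Longrightarrow>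
      \<bar>real_of_int (poly F1 x)\<bar> \<le> C1 * t ^ degree F1"
    by (rule abs_poly_int_upper_bound) blast
  obtain C2 where C2: "C2 > 0" "\<And>x t. \<lbrakk>1 \<le> t; \<bar>real_of_int x\<bar> \<le> t\<rbrakk> \<Longrightarrow>
      \<bar>real_of_int (poly F2 x)\<bar> \<le> C2 * t ^ degree F2"
    by (rule abs_poly_int_upper_bound) blast
  obtain C3 where C3: "C3 > 0" "\<And>x t. \<lbrakk>1 \<le> t; \<bar>real_of_int x\<bar> \<le> t\<rbrakk> \<Longrightarrow>
      \<bar>real_of_int (poly G x)\<bar> \<le> C3 * t ^ degree G"
    by (rule abs_poly_int_upper_bound) blast
  \<comment> \<open>Chosen so that D (1 + \<epsilon>) < D + 1; the denominator is positive even when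
    \<open>D\<close> is 0.\<close>
  define \<epsilon> :: real where "\<epsilon> = 1 / (real D + 1)"
  have eps: "\<epsilon> > 0" by (simp add: \<epsilon>_def)
  obtain C where C: "C > 0"
    "\<And>a b c :: int. \<lbrakk>a \<noteq> 0; b \<noteq> 0; c \<noteq> 0; coprime a b; a + b = c\<rbrakk> \<Longrightarrow>
       \<bar>real_of_int c\<bar> \<le> C * real (\<Prod>(prime_factors (nat \<bar>a * b * c\<bar>))) powr (1 + \<epsilon>)"
    using ABC_conjecture_int[OF \<open>ABC_conjecture\<close> eps] by blast
  \<comment> \<open>\<open>M'\<close> covers the small x, where \<open>low_f\<close> does not apply;
    the other entry forces c' K > Cg, which contradicts the growth bounds if |x| > K |y|.\<close>
  define K where "K = max M' (1 + Cg / c')"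
  have K: "K \<ge> 1" using c' by (simp add: K_def)
  define L where "L = C1 * K ^ degree F1 * (C2 * K ^ degree F2) * C3"
  have L: "L > 0" using C1(1) C2(1) C3(1) K by (simp add: L_def)
  \<comment> \<open>What remains as a bound for |y| in \<open>y_le\<close> after |y|^(D+1) is
    cancelled.\<close>
  define Y where "Y = \<bar>real_of_int r\<bar> * C * L powr (1 + \<epsilon>) / c"

  have x_le: "\<bar>real_of_int x\<bar> \<le> K * \<bar>real_of_int y\<bar>"
    if eq: "poly f x = poly g y" and y: "1 \<le> \<bar>real_of_int y\<bar>" for x y
  proof (cases "M' \<le> \<bar>real_of_int x\<bar>")
    case False
    hence "\<bar>real_of_int x\<bar> \<le> K * 1" by (simp add: K_def)
    also have "\<dots> \<le> K * \<bar>real_of_int y\<bar>" using K y by (intro mult_left_mono) auto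
    finally show ?thesis .
  next
    case True
    define s t where "s = \<bar>real_of_int x\<bar>" and "t = \<bar>real_of_int y\<bar>"
    show ?thesis
    proof (rule ccontr)
      assume "\<not> ?thesis"
      hence lt: "K * t < s" by (simp add: s_def t_def)
      have t1: "1 \<le> t" using y by (simp add: t_def)
      have df: "degree f > 0" using D deg1 by (simp add: f_def)
      \<comment> \<open>One factor \<open>K\<close> is kept from its power, since a contradiction
        only requires c' K \<le> Cg.\<close>
      have "c' * K * t ^ degree f \<le> c' * (K ^ degree f * t ^ degree f)"
        using c' K df t1 self_le_power[OF K df] by simp
      also have "\<dots> = c' * (K * t) ^ degree f" by (simp add: power_mult_distrib)
      also have "\<dots> \<le> c' * s ^ degree f"
        using c' lt K t1 by (intro mult_left_mono power_mono) auto
      also have "\<dots> \<le> \<bar>real_of_int (poly g y)\<bar>" using low_f[OF True] by (simp add: s_def eq)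
      also have "\<dots> \<le> Cg * t ^ degree g" using Cg(2)[OF y] by (simp add: t_def)
      also have "\<dots> \<le> Cg * t ^ degree f"
        using Cg(1) t1 deg1 by (intro mult_left_mono power_increasing) (auto simp: f_def)
      finally have "c' * K \<le> Cg" using t1 by simp
      moreover have "c' * (1 + Cg / c') \<le> c' * K" using c' by (simp add: K_def)
      moreover have "c' * (1 + Cg / c') = c' + Cg" using c' by (simp add: field_simps)
      ultimately show False using c' by linarith
    qed
  qed

  have y_le: "\<bar>real_of_int y\<bar> \<le> Y"
    if eq: "poly f x = poly g y" and M: "M \<le> \<bar>real_of_int y\<bar>"
      and F1: "poly F1 x \<noteq> 0" and F2: "poly F2 x \<noteq> 0" and G: "poly G y \<noteq> 0" for x y
  proof -
    define t where "t = \<bar>real_of_int y\<bar>"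
    have t1: "1 \<le> t" using M c by (simp add: t_def)
    have Kt: "\<bar>real_of_int x\<bar> \<le> K * t" using x_le[OF eq] t1 by (simp add: t_def)
    have Kt1: "1 \<le> K * t" using K t1 mult_mono[of 1 K 1 t] by simp
    define d where "d = gcd (poly A x) (poly B x)"
    have A0: "poly A x \<noteq> 0" using root[OF F1 dvd(1)] .
    have B0: "poly B x \<noteq> 0" using root[OF F2 dvd(2)] .
    have G0: "poly g y \<noteq> 0" using root[OF G dvd(3)] .
    have d0: "d > 0" using A0 by (simp add: d_def)
    \<comment> \<open>Evaluating the Bezout identity at \<open>x\<close> makes \<open>d\<close> a
      divisor of the fixed nonzero \<open>r\<close>.\<close>
    have "d dvd poly u x * poly A x + poly v x * poly B x" by (simp add: d_def)
    also have "\<dots> = r" using arg_cong[OF r(2), of "\<lambda>p. poly p x"] by simp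
    finally have dr: "d \<le> \<bar>r\<bar>" using r(1) dvd_imp_le_int[of r d] by simp
    obtain a b where a: "poly A x = a * d" and b: "poly B x = b * d" and ab: "coprime a b"
      using gcd_coprime_exists[of "poly A x" "poly B x"] d0 unfolding d_def by auto
    have gd: "poly g y = (a + b) * d" using eq a b by (simp add: f_def algebra_simps)
    define N where "N = poly F1 x * poly F2 x * poly G y"
    have N0: "N \<noteq> 0" using F1 F2 G by (simp add: N_def)
    have pd: "p dvd poly F z" if "prime p" "p dvd poly P z" "P dvd F ^ k" for P F k z and p :: int
    proof -
      from that(3) have "poly P z dvd poly F z ^ k" by (metis dvd_def poly_mult poly_power)
      with that(2) have "p dvd poly F z ^ k" by (rule dvd_trans)
      with that(1) show ?thesis by (rule prime_dvd_power)
    qed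
    \<comment> \<open>A prime of the reduced triple divides A(x), B(x) or g(y), hence a power of
      F1(x), F2(x) or G(y), hence that value itself.\<close>
    have "prime_factors (nat \<bar>a * b * (a + b)\<bar>) \<subseteq> prime_factors (nat \<bar>N\<bar>)"
    proof
      fix p assume "p \<in> prime_factors (nat \<bar>a * b * (a + b)\<bar>)"
      hence p: "prime (int p)" "int p dvd a * b * (a + b)"
        by (auto simp: in_prime_factors_iff)
      from p have "int p dvd poly A x \<or> int p dvd poly B x \<or> int p dvd poly g y"
        unfolding a b gd by (auto simp: prime_dvd_mult_iff)
      hence "int p dvd N" using pd[OF p(1)] dvd unfolding N_def by (meson dvd_mult dvd_mult2)
      thus "p \<in> prime_factors (nat \<bar>N\<bar>)" using p N0 by (auto simp: in_prime_factors_iff)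
    qed
    hence "\<Prod>(prime_factors (nat \<bar>a * b * (a + b)\<bar>)) \<le> \<Prod>(prime_factors (nat \<bar>N\<bar>))"
      by (intro dvd_imp_le prod_dvd_prod_subset) (auto intro!: prod_pos simp: in_prime_factors_iff prime_gt_0_nat)
    also have "\<dots> \<le> nat \<bar>N\<bar>" using N0 by (intro prod_prime_factors_le) simp
    finally have rad: "real (\<Prod>(prime_factors (nat \<bar>a * b * (a + b)\<bar>))) \<le> real (nat \<bar>N\<bar>)"
      by linarith
    have "real (nat \<bar>N\<bar>) = \<bar>real_of_int (poly F1 x)\<bar> * \<bar>real_of_int (poly F2 x)\<bar> * \<bar>real_of_int (poly G y)\<bar>"
      by (simp add: N_def abs_mult)
    also have "\<dots> \<le> (C1 * (K * t) ^ degree F1) * (C2 * (K * t) ^ degree F2) * (C3 * t ^ degree G)"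
      using C1(1) C2(1) C3(1) Kt1 t1 C1(2)[OF Kt1 Kt] C2(2)[OF Kt1 Kt] C3(2)[OF t1, of y]
      by (intro mult_mono) (auto simp: t_def)
    also have "\<dots> = L * t ^ D" by (simp add: L_def D_def power_mult_distrib power_add)
    finally have Nle: "real (nat \<bar>N\<bar>) \<le> L * t ^ D" .
    have "\<bar>real_of_int (a + b)\<bar>
        \<le> C * real (\<Prod>(prime_factors (nat \<bar>a * b * (a + b)\<bar>))) powr (1 + \<epsilon>)"
      using A0 B0 G0 ab unfolding a b gd by (intro C(2)) auto
    also have "\<dots> \<le> C * (L * t ^ D) powr (1 + \<epsilon>)"
      using C(1) eps rad Nle by (intro mult_left_mono powr_mono2) (auto intro: prod_nonneg)
    also have "(L * t ^ D) powr (1 + \<epsilon>) = L powr (1 + \<epsilon>) * t powr (real D * (1 + \<epsilon>))"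
      using L t1 by (simp add: powr_mult powr_powr flip: powr_realpow)
    also have "t powr (real D * (1 + \<epsilon>)) \<le> t powr (real (D + 1))"
      using t1 by (intro powr_mono) (auto simp: \<epsilon>_def field_simps)
    also have "t powr (real (D + 1)) = t ^ (D + 1)" using t1 by (subst powr_realpow) auto
    finally have ab_le: "\<bar>real_of_int (a + b)\<bar> \<le> C * (L powr (1 + \<epsilon>) * t ^ (D + 1))"
      using C(1) L by (simp add: mult_left_mono)
    \<comment> \<open>The lower bound for |g(y)| has one more power of \<open>t\<close> than the ABC
      bound; splitting it off leaves a bound on \<open>t\<close>.\<close>
    have "c * t * t ^ (D + 1) = c * t ^ (D + 2)" by simp
    also have "\<dots> \<le> c * t ^ degree g"
      using c t1 D by (intro mult_left_mono power_increasing) auto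
    also have "\<dots> \<le> \<bar>real_of_int (poly g y)\<bar>" using low_g[OF M] by (simp add: t_def)
    also have "\<dots> = real_of_int d * \<bar>real_of_int (a + b)\<bar>"
      using d0 by (simp add: gd abs_mult)
    also have "\<dots> \<le> \<bar>real_of_int r\<bar> * (C * (L powr (1 + \<epsilon>) * t ^ (D + 1)))"
      using dr d0 ab_le by (intro mult_mono) auto
    also have "\<dots> = (\<bar>real_of_int r\<bar> * C * L powr (1 + \<epsilon>)) * t ^ (D + 1)" by (simp add: mult_ac)
    finally have "c * t \<le> \<bar>real_of_int r\<bar> * C * L powr (1 + \<epsilon>)"
      by (rule mult_right_le_imp_le) (use t1 in simp)
    thus ?thesis using c by (simp add: Y_def t_def field_simps)
  qed

  \<comment> \<open>\<open>X\<close> and \<open>Z\<close> collect the exceptional values: zeros,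
    where an entry of the triple may vanish and ABC is silent, and the y too small to be excluded by
    \<open>y_le\<close>.\<close>
  define X where "X = {x. poly (F1 * F2) x = 0}"
  define Z where "Z = {y. poly G y = 0} \<union> {- \<lceil>max M Y\<rceil>..\<lceil>max M Y\<rceil>}"
  have "finite X" "finite Z" using nz by (auto simp: X_def Z_def simp del: poly_mult intro!: poly_roots_finite)
  have "x \<in> X \<or> y \<in> Z" if eq: "poly f x = poly g y" for x y
  proof (rule ccontr)
    assume "\<not> ?thesis"
    hence F: "poly F1 x \<noteq> 0" "poly F2 x \<noteq> 0" and G: "poly G y \<noteq> 0"
      and y: "y \<notin> {- \<lceil>max M Y\<rceil>..\<lceil>max M Y\<rceil>}" by (simp_all add: X_def Z_def)
    from y have "max M Y < \<bar>real_of_int y\<bar>" unfolding atLeastAtMost_iff by linarith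
    thus False using y_le[OF eq _ F G] by simp
  qed
  \<comment> \<open>Fixing one exceptional coordinate leaves the other in a finite fibre of
    \<open>g\<close> or \<open>f\<close>.\<close>
  hence "{(x, y). poly f x = poly g y} \<subseteq> Sigma X (\<lambda>x. {y. poly g y = poly f x})
      \<union> (\<lambda>(y, x). (x, y)) ` Sigma Z (\<lambda>y. {x. poly f x = poly g y})"
    by (fastforce simp: image_iff)
  moreover have "finite \<dots>" using \<open>finite X\<close> \<open>finite Z\<close> fin_f fin_g by (auto intro!: finite_SigmaI)
  ultimately show ?thesis unfolding f_def by (rule finite_subset)
qed

theorem theorem1p4:
  fixes l m n :: nat
    and f1 f2 gs :: "nat \<Rightarrow> int poly"
    and \<alpha> \<beta> \<gamma> :: "nat \<Rightarrow> nat"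
    and f g :: "int poly"
  assumes "l > 0" and "m > 0" and "n > 0"
    and "\<And>i. i \<in> {1..l} \<Longrightarrow> \<alpha> i > 0"
    and "\<And>j. j \<in> {1..m} \<Longrightarrow> \<beta> j > 0"
    and "\<And>k. k \<in> {1..n} \<Longrightarrow> \<gamma> k > 0"
    and f: "f = (\<Prod>i=1..l. f1 i ^ \<alpha> i) + (\<Prod>j=1..m. f2 j ^ \<beta> j) \<or>
            f = (\<Prod>i=1..l. f1 i ^ \<alpha> i) - (\<Prod>j=1..m. f2 j ^ \<beta> j)"
    and g: "g = (\<Prod>k=1..n. gs k ^ \<gamma> k)"
    and deg1: "degree g < degree f"
    and deg2: "degree g > 1 + degree ((\<Prod>i=1..l. f1 i) * (\<Prod>j=1..m. f2 j) * (\<Prod>k=1..n. gs k))"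
    and cop: "coprime (\<Prod>i=1..l. f1 i) (\<Prod>j=1..m. f2 j)"
    and "lead_coeff (\<Prod>i=1..l. f1 i) > 0"
    and "lead_coeff (\<Prod>j=1..m. f2 j) > 0"
    and "lead_coeff (\<Prod>k=1..n. gs k) > 0"
    and "ABC_conjecture"
  shows "finite {(x :: int, y :: int). poly f x = poly g y}"
proof -
  let ?A = "\<Prod>i=1..l. f1 i ^ \<alpha> i" and ?B = "\<Prod>j=1..m. f2 j ^ \<beta> j"
  let ?F1 = "\<Prod>i=1..l. f1 i" and ?F2 = "\<Prod>j=1..m. f2 j" and ?G = "\<Prod>k=1..n. gs k"
  \<comment> \<open>Both choices of sign become a sum; negation changes neither divisibility nor
    coprimality.\<close>
  obtain B where B: "B = ?B \<or> B = - ?B" and fB: "f = ?A + B"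
    using f by force
  have A_dvd: "?A dvd ?F1 ^ (\<Sum>i=1..l. \<alpha> i)" by (rule prod_power_dvd_power_prod) simp
  have B_dvd: "B dvd ?F2 ^ (\<Sum>j=1..m. \<beta> j)"
    using B prod_power_dvd_power_prod[of "{1..m}" f2 \<beta>] by auto
  have g_dvd: "g dvd ?G ^ (\<Sum>k=1..n. \<gamma> k)"
    unfolding g by (rule prod_power_dvd_power_prod) simp
  have "coprime ?A B"
    using coprime_divisors[OF A_dvd B_dvd] cop
    by (metis coprime_power_left_iff coprime_power_right_iff)
  moreover have "?F1 \<noteq> 0" "?F2 \<noteq> 0" "?G \<noteq> 0" using assms(12-14) by (metis coeff_0 less_irrefl)+
  ultimately show ?thesis
    using finite_solutions_of_ABC[OF \<open>ABC_conjecture\<close> _ A_dvd B_dvd g_dvd] deg1 deg2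
    unfolding fB by simp
qed

end
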